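(* Consider the following spectral algorithm: on input a graph $G$ on $n$ vertices with signed adjacency matrix $S$, compute the largest eigenvalue $\lambda_1(S)$ and certify that $G$ does not contain any $k$-subgraph with excess $\epsilon$, for all $k,\epsilon$ such that $2\epsilon(k-1) > \lambda_1(S)$. Then every such certification is correct, and the algorithm certifies that most graphs on $n$ vertices do not contain any $k$-subgraph with excess $\epsilon$ for all $k,\epsilon$ such that $2\epsilon(k-1) \ge 3\sqrt{n}$.
   Context: The signed adjacency matrix $S$ of a graph $G$ on $\{1,\dots,n\}$ has $S_{ii}=0$, $S_{ij}=1$ if $ij$ is an edge and $S_{ij}=-1$ otherwise. A graph on $k$ vertices has density $\lambda$ if it has at least $\lambda k(k-1)/2$ edges, and excess $\epsilon\ge0$ if it has density $1/2+\epsilon$. A $k$-subgraph is an induced subgraph on $k$ vertices. "Most graphs on $n$ vertices" means a fraction of the graphs on $\{1,\dots,n\}$ tending to $1$ as $n\to\infty$. *)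

theory Defs
  imports "Jordan_Normal_Form.Spectral_Radius"
begin

definition graphs_on :: "'a set \<Rightarrow> 'a set set set" where
  "graphs_on V = Pow {e. e \<subseteq> V \<and> card e = 2}"

definition induced_edges :: "'a set set \<Rightarrow> 'a set \<Rightarrow> 'a set set" where
  "induced_edges E W = {e \<in> E. e \<subseteq> W}"

definition has_density :: "'a set \<Rightarrow> 'a set set \<Rightarrow> real \<Rightarrow> bool" where
  "has_density V E d \<longleftrightarrow> real (card E) \<ge> d * real (card V) * (real (card V) - 1) / 2"

definition has_excess :: "'a set \<Rightarrow> 'a set set \<Rightarrow> real \<Rightarrow> bool" where
  "has_excess V E eps \<longleftrightarrow> eps \<ge> 0 \<and> has_density V E (1 / 2 + eps)"

definition contains_subgraph_with_excess ::
  "'a set \<Rightarrow> 'a set set \<Rightarrow> nat \<Rightarrow> real \<Rightarrow> bool" where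
  "contains_subgraph_with_excess V E k eps \<longleftrightarrow>
     (\<exists>W\<subseteq>V. card W = k \<and> has_excess W (induced_edges E W) eps)"

text \<open>Vertices are numbered from 1 and matrix indices from 0, so row \<open>i\<close> belongs to vertex \<open>i + 1\<close>.\<close>

definition signed_adjacency :: "nat \<Rightarrow> nat set set \<Rightarrow> real mat" where
  "signed_adjacency n E = mat n n (\<lambda>(i, j).
     if i = j then 0 else if {i + 1, j + 1} \<in> E then 1 else - 1)"

text \<open>Meaningful only for real matrices with at least one real eigenvalue, such as symmetric
  matrices of positive dimension.\<close>

definition largest_eigenvalue :: "real mat \<Rightarrow> real" where
  "largest_eigenvalue A = Max (spectrum A)"

text \<open>The output of the spectral algorithm: the pairs \<open>(k, eps)\<close> for which it certifies that
  the graph contains no \<open>k\<close>-subgraph with excess \<open>eps\<close>. The factor \<open>k - 1\<close> is computed in the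
  reals, so it is \<open>-1\<close> for \<open>k = 0\<close>.\<close>

definition spectrally_certified :: "nat \<Rightarrow> nat set set \<Rightarrow> (nat \<times> real) set" where
  "spectrally_certified n E =
     {(k, eps). eps \<ge> 0 \<and> 2 * eps * (real k - 1) > largest_eigenvalue (signed_adjacency n E)}"

end

theory Submission
  imports "HOL-Analysis.Weierstrass_Theorems" Defs
begin

text \<open>
  A \<open>k\<close>-subgraph with excess \<open>\<epsilon>\<close> has an indicator vector with Rayleigh quotient at least
  \<open>2\<epsilon>(k - 1)\<close>, so correctness is the variational bound for the largest eigenvalue.

  For random \<open>S\<close> the bound \<open>\<lambda>\<^sub>1(S) < 3\<surd>n\<close> comes from a change of measure instead of nets or moments.
  For every fixed vector \<open>x\<close>, \<open>exp (t x\<^sup>TSx - t\<^sup>2 \<Sum>\<^sub>i\<^sub>\<noteq>\<^sub>j x\<^sub>i\<^sup>2 x\<^sub>j\<^sup>2)\<close> has mean at most 1 over all graphs,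
  because \<open>cosh a \<le> exp (a\<^sup>2/2)\<close>. Let \<open>\<Phi>(S)\<close> be the average of this expression when the coordinates of
  \<open>x\<close> are independent centred binomials of variance \<open>1/n\<close>, a discrete stand-in for Gaussians. If \<open>w\<close> is
  a unit eigenvector for \<open>\<lambda>\<^sub>1\<close>, tilting the \<open>i\<close>-th coordinate to mean \<open>w\<^sub>i\<close> costs relative entropy at most
  \<open>(25/48) n w\<^sub>i\<^sup>2\<close>, and the Gibbs variational principle gives
  \<open>\<Phi>(S) \<ge> exp (t \<lambda>\<^sub>1 - 4 t\<^sup>2 - 25n/48)\<close>. With \<open>t = (3/8) \<surd>n\<close> this is at least \<open>exp (n/24)\<close> whenever
  \<open>\<lambda>\<^sub>1 \<ge> 3\<surd>n\<close>, so by Markov's inequality that happens for at most a fraction \<open>exp (-n/24)\<close> of graphs.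
\<close>

unbundle no inner_syntax and no vec_syntax

section \<open>The variational bound for the largest eigenvalue\<close>

text \<open>Cauchy-Schwarz in each row. \<open>C\<close> is the squared Frobenius norm, plus 1 so
  that it stays positive for the zero matrix.\<close>

lemma mult_mat_vec_norm_bound:
  fixes A :: "real mat"
  assumes A: "A \<in> carrier_mat nr nc"
  obtains C where "C > 0"
    "\<And>x. x \<in> carrier_vec nc \<Longrightarrow> (A *\<^sub>v x) \<bullet> (A *\<^sub>v x) \<le> C * (x \<bullet> x)"
proof
  define C where "C = 1 + (\<Sum>i<nr. \<Sum>j<nc. (A $$ (i,j))\<^sup>2)"
  show "C > 0" unfolding C_def by (intro add_pos_nonneg sum_nonneg) auto
  fix x :: "real vec" assume x: "x \<in> carrier_vec nc"
  have xx: "x \<bullet> x = (\<Sum>j<nc. (x $ j)\<^sup>2)"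
    using x by (auto simp: scalar_prod_def power2_eq_square atLeast0LessThan)
  have "(A *\<^sub>v x) \<bullet> (A *\<^sub>v x) = (\<Sum>i<nr. (\<Sum>j<nc. A $$ (i,j) * x $ j)\<^sup>2)"
    using x A by (auto simp: scalar_prod_def power2_eq_square atLeast0LessThan intro!: sum.cong)
  also have "\<dots> \<le> (\<Sum>i<nr. (\<Sum>j<nc. (A $$ (i,j))\<^sup>2) * (\<Sum>j<nc. (x $ j)\<^sup>2))"
    by (intro sum_mono Cauchy_Schwarz_ineq_sum)
  also have "\<dots> = (C - 1) * (x \<bullet> x)"
    by (simp add: C_def xx sum_distrib_right)
  also have "\<dots> \<le> C * (x \<bullet> x)"
    by (intro mult_right_mono) (auto simp: xx sum_nonneg)
  finally show "(A *\<^sub>v x) \<bullet> (A *\<^sub>v x) \<le> C * (x \<bullet> x)" .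
qed

lemma scalar_prod_self_nonneg: "x \<bullet> x \<ge> (0::real)"
  by (simp add: scalar_prod_def sum_nonneg)

lemma scalar_prod_self_eq_0_iff:
  fixes x :: "real vec"
  assumes "x \<in> carrier_vec n"
  shows "x \<bullet> x = 0 \<longleftrightarrow> x = 0\<^sub>v n"
  using assms by (auto simp: scalar_prod_def sum_nonneg_eq_0_iff)

text \<open>Bounding each product \<open>x $ i * ?y $ i\<close> by the sum of the two squares
  reduces the form to the norm bound for \<open>A\<close>.\<close>

lemma abs_quadratic_form_le:
  fixes A :: "real mat"
  assumes A: "A \<in> carrier_mat n n"
  obtains K where "K > 0" "\<And>x. x \<in> carrier_vec n \<Longrightarrow> \<bar>x \<bullet> (A *\<^sub>v x)\<bar> \<le> K * (x \<bullet> x)"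
proof -
  obtain C where C: "C > 0"
    "\<And>x. x \<in> carrier_vec n \<Longrightarrow> (A *\<^sub>v x) \<bullet> (A *\<^sub>v x) \<le> C * (x \<bullet> x)"
    using mult_mat_vec_norm_bound[OF A] by blast
  show ?thesis
  proof
    show "1 + C > 0" using C by simp
    fix x :: "real vec" assume x: "x \<in> carrier_vec n"
    let ?y = "A *\<^sub>v x"
    have "\<bar>x \<bullet> ?y\<bar> \<le> (\<Sum>i<n. \<bar>x $ i * ?y $ i\<bar>)"
      using x A by (auto simp: scalar_prod_def atLeast0LessThan intro!: sum_abs)
    also have "\<dots> \<le> (\<Sum>i<n. x $ i * x $ i + ?y $ i * ?y $ i)"
    proof (rule sum_mono)
      fix i
      have "\<bar>a * b\<bar> \<le> a * a + b * b" for a b :: real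
        using sum_squares_bound[of "\<bar>a\<bar>" "\<bar>b\<bar>"] abs_ge_zero[of "a * b"]
        unfolding abs_mult power2_eq_square abs_mult_self_eq by linarith
      then show "\<bar>x $ i * ?y $ i\<bar> \<le> x $ i * x $ i + ?y $ i * ?y $ i" .
    qed
    also have "\<dots> = x \<bullet> x + ?y \<bullet> ?y"
      using x A by (auto simp: scalar_prod_def atLeast0LessThan sum.distrib)
    also have "\<dots> \<le> (1 + C) * (x \<bullet> x)"
      using C(2)[OF x] by (simp add: algebra_simps)
    finally show "\<bar>x \<bullet> ?y\<bar> \<le> (1 + C) * (x \<bullet> x)" .
  qed
qed

lemma quadratic_form_symmetric:
  fixes A :: "real mat"
  assumes A: "A \<in> carrier_mat n n" and sym: "A\<^sup>T = A"
    and x: "x \<in> carrier_vec n" and y: "y \<in> carrier_vec n"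
  shows "x \<bullet> (A *\<^sub>v y) = y \<bullet> (A *\<^sub>v x)"
proof -
  have "x \<bullet> (A *\<^sub>v y) = (A\<^sup>T *\<^sub>v x) \<bullet> y"
    using transpose_vec_mult_scalar[OF A y x] by simp
  then show ?thesis using sym A x y by (simp add: comm_scalar_prod[of _ n])
qed

text \<open>Semidefiniteness gives \<open>\<bar>Mx\<bar>\<^sup>2 \<le> - K x\<^sup>TMx\<close> (test the form on \<open>x + Mx / K\<close>), and invertibility
  bounds \<open>\<bar>x\<bar>\<close> by \<open>\<bar>Mx\<bar>\<close>.\<close>
lemma neg_semidefinite_invertible_imp_definite:
  fixes M :: "real mat"
  assumes M: "M \<in> carrier_mat n n" and sym: "M\<^sup>T = M" and det: "det M \<noteq> 0"
    and neg: "\<And>x. x \<in> carrier_vec n \<Longrightarrow> x \<bullet> (M *\<^sub>v x) \<le> 0"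
  obtains d where "d > 0" "\<And>x. x \<in> carrier_vec n \<Longrightarrow> x \<bullet> (M *\<^sub>v x) \<le> - d * (x \<bullet> x)"
proof -
  obtain D where D: "D \<in> carrier_mat n n" "D * M = 1\<^sub>m n"
    using det_non_zero_imp_unit[OF M det, of "()"] by (auto simp: Units_def ring_mat_simps)
  obtain C where C: "C > 0" "\<And>x. x \<in> carrier_vec n \<Longrightarrow> (D *\<^sub>v x) \<bullet> (D *\<^sub>v x) \<le> C * (x \<bullet> x)"
    using mult_mat_vec_norm_bound[OF D(1)] by blast
  obtain K where K: "K > 0" "\<And>x. x \<in> carrier_vec n \<Longrightarrow> \<bar>x \<bullet> (M *\<^sub>v x)\<bar> \<le> K * (x \<bullet> x)"
    using abs_quadratic_form_le[OF M] by blast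
  show ?thesis
  proof
    show "1 / (K * C) > 0" using K C by simp
    fix x :: "real vec" assume x: "x \<in> carrier_vec n"
    define y where "y = M *\<^sub>v x"
    have y: "y \<in> carrier_vec n" unfolding y_def using M x by simp
    have My: "M *\<^sub>v y \<in> carrier_vec n" using M y by simp
    have "D *\<^sub>v y = (D * M) *\<^sub>v x" unfolding y_def using D(1) M x by simp
    then have xD: "D *\<^sub>v y = x" using D x by simp
    have xy: "x \<bullet> x \<le> C * (y \<bullet> y)" using C(2)[OF y] xD by simp
    let ?z = "x + (1/K) \<cdot>\<^sub>v y"
    have z: "?z \<in> carrier_vec n" using x y by simp
    have Mz: "M *\<^sub>v ?z = y + (1/K) \<cdot>\<^sub>v (M *\<^sub>v y)"
      using M x y by (simp add: mult_add_distrib_mat_vec[of _ n n] mult_mat_vec[of _ n n] y_def)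
    have xMy: "x \<bullet> (M *\<^sub>v y) = y \<bullet> y"
      using quadratic_form_symmetric[OF M sym x y] by (simp add: y_def)
    \<comment> \<open>Both cross terms equal \<open>(y \<bullet> y) / K\<close>, one by the
      definition of \<open>y\<close> and one by symmetry of \<open>M\<close>. The last term takes
      back at most one of them, so semidefiniteness at \<open>?z\<close> leaves
      \<open>x \<bullet> y + (y \<bullet> y) / K \<le> 0\<close>.\<close>
    have "?z \<bullet> (M *\<^sub>v ?z) = x \<bullet> y + (2/K) * (y \<bullet> y) + (1/K)\<^sup>2 * (y \<bullet> (M *\<^sub>v y))"
      unfolding Mz using x y My xMy
      by (simp add: add_scalar_prod_distrib[of _ n] scalar_prod_add_distrib[of _ n]
          field_simps power2_eq_square)
    moreover have "(1/K)\<^sup>2 * (y \<bullet> (M *\<^sub>v y)) \<ge> (1/K)\<^sup>2 * (- K * (y \<bullet> y))"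
      using K(2)[OF y] by (intro mult_left_mono) auto
    moreover have "(1/K)\<^sup>2 * (- K * (y \<bullet> y)) = - (1/K) * (y \<bullet> y)"
      using K(1) by (simp add: power2_eq_square)
    ultimately have "x \<bullet> y \<le> - (1/K) * (y \<bullet> y)"
      using neg[OF z] by (simp add: field_simps)
    also have "\<dots> \<le> - (1/(K*C)) * (x \<bullet> x)"
      using xy K C by (simp add: field_simps)
    finally show "x \<bullet> (M *\<^sub>v x) \<le> - (1 / (K * C)) * (x \<bullet> x)" by (simp add: y_def)
  qed
qed

text \<open>\<open>m\<close> is the supremum of the form over unit vectors; no maximiser is
  constructed. If \<open>m\<close> were not an eigenvalue, \<open>A - m I\<close> would be
  invertible and negative semidefinite, hence negative definite with some gap \<open>d\<close>, and
  the supremum would be at most \<open>m - d\<close>.\<close>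

lemma quadratic_form_le_spectrum:
  fixes A :: "real mat"
  assumes A: "A \<in> carrier_mat n n" and sym: "A\<^sup>T = A" and n: "n > 0"
  obtains m where "m \<in> spectrum A"
    "\<And>x. x \<in> carrier_vec n \<Longrightarrow> x \<bullet> (A *\<^sub>v x) \<le> m * (x \<bullet> x)"
proof -
  obtain K where K: "K > 0" "\<And>x. x \<in> carrier_vec n \<Longrightarrow> \<bar>x \<bullet> (A *\<^sub>v x)\<bar> \<le> K * (x \<bullet> x)"
    using abs_quadratic_form_le[OF A] by blast
  define R where "R = {x \<bullet> (A *\<^sub>v x) | x. x \<in> carrier_vec n \<and> x \<bullet> x = 1}"
  have bdd: "bdd_above R"
    unfolding R_def bdd_above_def using K(2) by (force intro!: exI[of _ K])
  have "unit_vec n 0 \<bullet> (unit_vec n 0 :: real vec) = 1" using n by simp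
  then have ne: "R \<noteq> {}" unfolding R_def using unit_vec_carrier[of n 0] by blast
  define m where "m = Sup R"
  have scaled: "x \<bullet> (A *\<^sub>v x) \<le> b * (x \<bullet> x)"
    if b: "\<And>r. r \<in> R \<Longrightarrow> r \<le> b" and x: "x \<in> carrier_vec n" for x b
  proof (cases "x \<bullet> x = 0")
    case True
    then have "x = 0\<^sub>v n" using x scalar_prod_self_eq_0_iff by blast
    then show ?thesis using A by simp
  next
    case False
    then have pos: "x \<bullet> x > 0" using scalar_prod_self_nonneg[of x] by simp
    define s where "s = 1 / sqrt (x \<bullet> x)"
    have s2: "s * s = 1 / (x \<bullet> x)" using pos by (simp add: s_def)
    have "(s \<cdot>\<^sub>v x) \<bullet> (s \<cdot>\<^sub>v x) = (s * s) * (x \<bullet> x)" using x by simp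
    also have "\<dots> = 1" using s2 pos by simp
    finally have "(s \<cdot>\<^sub>v x) \<bullet> (A *\<^sub>v (s \<cdot>\<^sub>v x)) \<in> R" unfolding R_def using x by auto
    moreover have "(s \<cdot>\<^sub>v x) \<bullet> (A *\<^sub>v (s \<cdot>\<^sub>v x)) = (s * s) * (x \<bullet> (A *\<^sub>v x))"
      using x A by (simp add: mult_mat_vec[of _ n n])
    ultimately have "(x \<bullet> (A *\<^sub>v x)) / (x \<bullet> x) \<le> b" using b s2 by fastforce
    then show ?thesis using pos by (simp add: field_simps)
  qed
  have le: "x \<bullet> (A *\<^sub>v x) \<le> m * (x \<bullet> x)" if "x \<in> carrier_vec n" for x
    using scaled[OF _ that, of m] cSup_upper[OF _ bdd] by (simp add: m_def)
  define M where "M = char_matrix A m"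
  have M: "M \<in> carrier_mat n n" unfolding M_def using A by simp
  have Msym: "M\<^sup>T = M"
  proof (rule eq_matI)
    fix i j assume ij: "i < dim_row M" "j < dim_col M"
    have "A $$ (j, i) = A\<^sup>T $$ (i, j)" using ij A M by simp
    then show "M\<^sup>T $$ (i, j) = M $$ (i, j)"
      using ij A M sym by (auto simp: M_def char_matrix_def)
  qed (use M in auto)
  have Mx: "x \<bullet> (M *\<^sub>v x) = x \<bullet> (A *\<^sub>v x) - m * (x \<bullet> x)" if x: "x \<in> carrier_vec n" for x
  proof -
    have "M *\<^sub>v x = A *\<^sub>v x + (- m) \<cdot>\<^sub>v x"
      unfolding M_def char_matrix_def using A x
      by (intro eq_vecI) (auto simp: add_scalar_prod_distrib[of _ n])
    then show ?thesis using A x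
      by (simp add: scalar_prod_add_distrib[of _ n])
  qed
  have "m \<in> spectrum A"
  proof (rule ccontr)
    assume "m \<notin> spectrum A"
    then have "det M \<noteq> 0" using eigenvalue_det[OF A] by (simp add: spectrum_def M_def)
    then obtain d where d: "d > 0" "\<And>x. x \<in> carrier_vec n \<Longrightarrow> x \<bullet> (M *\<^sub>v x) \<le> - d * (x \<bullet> x)"
      using neg_semidefinite_invertible_imp_definite[OF M Msym] le Mx by (metis diff_le_0_iff_le)
    have "r \<le> m - d" if "r \<in> R" for r
      using that d(2) Mx unfolding R_def by fastforce
    then have "m \<le> m - d" unfolding m_def using cSup_least[OF ne] by blast
    then show False using d by simp
  qed
  then show ?thesis using le that by blast
qed

text \<open>Makes \<open>Max\<close> in \<open>largest_eigenvalue\<close> meaningful: the spectrum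
  is finite, and it is nonempty because some eigenvalue bounds the form. The maximum then bounds it
  too, as \<open>x \<bullet> x\<close> is nonnegative.\<close>

lemma quadratic_form_le_largest_eigenvalue:
  fixes A :: "real mat"
  assumes A: "A \<in> carrier_mat n n" and sym: "A\<^sup>T = A" and n: "n > 0"
  shows "largest_eigenvalue A \<in> spectrum A"
    and "\<And>x. x \<in> carrier_vec n \<Longrightarrow> x \<bullet> (A *\<^sub>v x) \<le> largest_eigenvalue A * (x \<bullet> x)"
proof -
  obtain m where m: "m \<in> spectrum A"
    "\<And>x. x \<in> carrier_vec n \<Longrightarrow> x \<bullet> (A *\<^sub>v x) \<le> m * (x \<bullet> x)"
    using quadratic_form_le_spectrum[OF assms] by blast
  have fin: "finite (spectrum A)" using card_finite_spectrum[OF A] by simp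
  show "largest_eigenvalue A \<in> spectrum A"
    unfolding largest_eigenvalue_def using fin m(1) by (intro Max_in) auto
  have "m \<le> largest_eigenvalue A"
    unfolding largest_eigenvalue_def using fin m(1) by simp
  then show "x \<bullet> (A *\<^sub>v x) \<le> largest_eigenvalue A * (x \<bullet> x)" if "x \<in> carrier_vec n" for x
    using m(2)[OF that] mult_right_mono[OF _ scalar_prod_self_nonneg[of x]] by fastforce
qed

section \<open>Change of measure\<close>

text \<open>The Gibbs variational principle, by Jensen: \<open>exp\<close> lies above its tangent at
  \<open>g\<close>, the mean of \<open>G\<close> under \<open>q\<close>. Since \<open>G\<close>
  contains the logarithm of the density ratio, \<open>q c * exp (G c)\<close> is exactly
  \<open>p c * exp (F c)\<close>.\<close>

lemma exp_expectation_minus_KL_le: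
  fixes p q F :: "'a \<Rightarrow> real"
  assumes q: "\<And>c. c \<in> C \<Longrightarrow> q c > 0" "sum q C = 1"
    and p: "\<And>c. c \<in> C \<Longrightarrow> p c > 0"
  shows "exp (\<Sum>c\<in>C. q c * (F c - ln (q c / p c))) \<le> (\<Sum>c\<in>C. p c * exp (F c))"
proof -
  define G where "G c = F c - ln (q c / p c)" for c
  define g where "g = (\<Sum>c\<in>C. q c * G c)"
  have "exp g = (\<Sum>c\<in>C. q c * (exp g * (1 + (G c - g))))"
  proof -
    have "(\<Sum>c\<in>C. q c * (exp g * (1 + (G c - g)))) =
        (\<Sum>c\<in>C. exp g * (1 - g) * q c + exp g * (q c * G c))"
      by (intro sum.cong) (simp_all add: algebra_simps)
    also have "\<dots> = exp g * (1 - g) * sum q C + exp g * g"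
      by (simp add: g_def sum.distrib flip: sum_distrib_left)
    finally have "(\<Sum>c\<in>C. q c * (exp g * (1 + (G c - g)))) = exp g * (1 - g) * sum q C + exp g * g" .
    then show ?thesis using q by (simp add: algebra_simps)
  qed
  also have "\<dots> \<le> (\<Sum>c\<in>C. q c * (exp g * exp (G c - g)))"
    using q(1) by (intro sum_mono mult_left_mono exp_ge_add_one_self) (auto simp: less_imp_le)
  also have "\<dots> = (\<Sum>c\<in>C. p c * exp (F c))"
  proof (rule sum.cong)
    fix c assume c: "c \<in> C"
    have "exp g * exp (G c - g) = exp (F c) * (p c / q c)"
      using q(1)[OF c] p[OF c] by (simp add: G_def exp_diff flip: exp_add)
    then show "q c * (exp g * exp (G c - g)) = p c * exp (F c)"
      using q(1)[OF c] by simp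
  qed simp
  finally show ?thesis by (simp add: g_def G_def)
qed

section \<open>Finite product measures: factorisation and marginals\<close>

lemma sum_PiE_product_weights:
  fixes q h :: "'a \<Rightarrow> 'b \<Rightarrow> real"
  assumes "finite V" "finite Y"
  shows "(\<Sum>c\<in>PiE V (\<lambda>_. Y). (\<Prod>k\<in>V. q k (c k)) * (\<Prod>k\<in>V. h k (c k))) =
    (\<Prod>k\<in>V. \<Sum>y\<in>Y. q k y * h k y)"
  using assms by (subst prod_sum_PiE) (auto simp: prod.distrib)

lemma product_weights_total:
  fixes q :: "'a \<Rightarrow> 'b \<Rightarrow> real"
  assumes "finite V" "finite Y" and q: "\<And>k. k \<in> V \<Longrightarrow> sum (q k) Y = 1"
  shows "(\<Sum>c\<in>PiE V (\<lambda>_. Y). \<Prod>k\<in>V. q k (c k)) = 1"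
  using sum_PiE_product_weights[OF assms(1,2), of q "\<lambda>_ _. 1"] q by simp

lemma product_weights_marginal:
  fixes q :: "'a \<Rightarrow> 'b \<Rightarrow> real"
  assumes fin: "finite V" "finite Y" and q: "\<And>k. k \<in> V \<Longrightarrow> sum (q k) Y = 1" and i: "i \<in> V"
  shows "(\<Sum>c\<in>PiE V (\<lambda>_. Y). (\<Prod>k\<in>V. q k (c k)) * f (c i)) = (\<Sum>y\<in>Y. q i y * f y)"
proof -
  let ?h = "\<lambda>k y. if k = i then f y else 1"
  have "(\<Prod>k\<in>V. ?h k (c k)) = f (c i)" for c
    using fin i by simp
  moreover have "(\<Prod>k\<in>V. \<Sum>y\<in>Y. q k y * ?h k y) = (\<Prod>k\<in>V. if k = i then \<Sum>y\<in>Y. q i y * f y else 1)"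
    using q by (intro prod.cong) auto
  ultimately show ?thesis
    using sum_PiE_product_weights[OF fin, of q ?h] fin i by simp
qed

text \<open>Independence of distinct coordinates: every factor other than \<open>i\<close> and
  \<open>j\<close> sums to 1.\<close>

lemma product_weights_two_marginals:
  fixes q :: "'a \<Rightarrow> 'b \<Rightarrow> real"
  assumes fin: "finite V" "finite Y" and q: "\<And>k. k \<in> V \<Longrightarrow> sum (q k) Y = 1"
    and ij: "i \<in> V" "j \<in> V" "i \<noteq> j"
  shows "(\<Sum>c\<in>PiE V (\<lambda>_. Y). (\<Prod>k\<in>V. q k (c k)) * (f (c i) * g (c j))) =
    (\<Sum>y\<in>Y. q i y * f y) * (\<Sum>y\<in>Y. q j y * g y)"
proof -
  let ?h = "\<lambda>k y. (if k = i then f y else 1) * (if k = j then g y else 1)"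
  have "(\<Prod>k\<in>V. ?h k (c k)) = f (c i) * g (c j)" for c
    using fin ij by (simp add: prod.distrib)
  moreover have "(\<Prod>k\<in>V. \<Sum>y\<in>Y. q k y * ?h k y) =
     (\<Prod>k\<in>V. (if k = i then \<Sum>y\<in>Y. q i y * f y else 1) * (if k = j then \<Sum>y\<in>Y. q j y * g y else 1))"
    using q ij by (intro prod.cong) auto
  ultimately show ?thesis
    using sum_PiE_product_weights[OF fin, of q ?h] fin ij by (simp add: prod.distrib)
qed

section \<open>Scalar inequalities and exponential moments of random signs\<close>

text \<open>The difference of the two sides has derivative \<open>x^3 / (1 + x)\<close>, which has
  the sign of \<open>x\<close>, so its minimum is the value 0 at 0.\<close>

lemma ln_one_plus_le_cubic:
  fixes b :: real
  assumes "b > -1"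
  shows "ln (1 + b) \<le> b - b^2 / 2 + b^3 / 3"
proof -
  define f where "f x = x - x^2 / 2 + x^3 / 3 - ln (1 + x)" for x :: real
  have der: "DERIV f x :> x^3 / (1 + x)" if "x > -1" for x
    unfolding f_def using that
    by (auto intro!: derivative_eq_intros simp: field_simps power2_eq_square power3_eq_cube)
  have "f 0 \<le> f b"
  proof (cases "b \<ge> 0")
    case True
    show ?thesis
    proof (rule DERIV_nonneg_imp_nondecreasing[OF True, where f = f])
      fix x assume x: "0 \<le> x" "x \<le> b"
      then show "\<exists>y. DERIV f x :> y \<and> y \<ge> 0"
        using der[of x] by (intro exI[of _ "x^3 / (1 + x)"]) auto
    qed
  next
    case False
    show ?thesis
    proof (rule DERIV_nonpos_imp_nonincreasing[where f = f])
      show "b \<le> 0" using False by simp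
      fix x assume x: "b \<le> x" "x \<le> 0"
      have "x^3 \<le> 0" using x by (simp add: power3_eq_cube mult_nonneg_nonpos)
      then show "\<exists>y. DERIV f x :> y \<and> y \<le> 0"
        using der[of x] x assms by (auto intro!: exI[of _ "x^3 / (1 + x)"] divide_nonpos_pos)
    qed
  qed
  then show ?thesis by (simp add: f_def)
qed

text \<open>For \<open>x \<ge> 0\<close> the function
  \<open>exp (- (x\<^sup>2 / 2)) * cosh x\<close> is nonincreasing because
  \<open>sinh y \<le> y * cosh y\<close>; evenness of \<open>cosh\<close> covers negative
  \<open>x\<close>.\<close>

lemma cosh_le_exp_half_square: "cosh x \<le> exp (x\<^sup>2 / 2)" for x :: real
proof -
  have *: "cosh x \<le> exp (x\<^sup>2 / 2)" if x: "x \<ge> 0" for x :: real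
  proof -
    have sinh: "sinh y \<le> y * cosh y" if "y \<ge> 0" for y :: real
    proof -
      have "0 * cosh 0 - sinh 0 \<le> y * cosh y - sinh y"
      proof (rule DERIV_nonneg_imp_nondecreasing[OF that])
        fix z :: real assume "0 \<le> z"
        then show "\<exists>d. DERIV (\<lambda>z. z * cosh z - sinh z) z :> d \<and> 0 \<le> d"
          by (intro exI[of _ "z * sinh z"]) (auto intro!: derivative_eq_intros)
      qed
      then show ?thesis by simp
    qed
    have "exp (- (x\<^sup>2 / 2)) * cosh x \<le> exp (- (0\<^sup>2 / 2)) * cosh 0"
    proof (rule DERIV_nonpos_imp_nonincreasing[OF x])
      fix z :: real assume "0 \<le> z"
      then show "\<exists>d. DERIV (\<lambda>z. exp (- (z\<^sup>2 / 2)) * cosh z) z :> d \<and> d \<le> 0"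
        using sinh[of z]
        by (intro exI[of _ "exp (- (z\<^sup>2 / 2)) * (sinh z - z * cosh z)"])
           (auto intro!: derivative_eq_intros mult_nonneg_nonpos simp: algebra_simps)
    qed
    then show ?thesis by (simp add: exp_minus field_simps)
  qed
  show ?thesis using *[of x] *[of "-x"] by (cases "x \<ge> 0") auto
qed

text \<open>A subset of \<open>P\<close> is a choice of signs, so the sum factors over
  \<open>P\<close> into terms \<open>2 * cosh (a e)\<close>. Divided by \<open>2 ^ card P\<close>,
  this is the sub-Gaussian bound for a weighted sum of independent random signs.\<close>

lemma sum_Pow_exp_signed_sum_le:
  fixes a :: "'a \<Rightarrow> real"
  assumes "finite P"
  shows "(\<Sum>E\<in>Pow P. exp (\<Sum>e\<in>P. (if e \<in> E then 1 else - 1) * a e)) \<le>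
    2 ^ card P * exp (\<Sum>e\<in>P. (a e)\<^sup>2 / 2)"
proof -
  have "(\<Sum>E\<in>Pow P. exp (\<Sum>e\<in>P. (if e \<in> E then 1 else - 1) * a e)) =
     (\<Sum>E\<in>Pow P. (\<Prod>e\<in>E. exp (a e)) * (\<Prod>e\<in>P-E. exp (- a e)))"
  proof (rule sum.cong)
    fix E assume "E \<in> Pow P"
    then have E: "E \<subseteq> P" by simp
    have "(\<Sum>e\<in>P. (if e \<in> E then 1 else - 1) * a e) =
      (\<Sum>e\<in>P-E. (if e \<in> E then 1 else - 1) * a e) + (\<Sum>e\<in>E. (if e \<in> E then 1 else - 1) * a e)"
      by (rule sum.subset_diff[OF E assms])
    also have "\<dots> = (\<Sum>e\<in>P-E. - a e) + (\<Sum>e\<in>E. a e)"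
      by (intro arg_cong2[where f = "(+)"] sum.cong) auto
    finally show "exp (\<Sum>e\<in>P. (if e \<in> E then 1 else - 1) * a e) =
        (\<Prod>e\<in>E. exp (a e)) * (\<Prod>e\<in>P-E. exp (- a e))"
      using E assms finite_subset[OF E]
      by (simp add: exp_add mult.commute flip: exp_sum)
  qed simp
  also have "\<dots> = (\<Prod>e\<in>P. exp (a e) + exp (- a e))"
    by (rule prod_add[OF assms, symmetric])
  also have "\<dots> = (\<Prod>e\<in>P. 2 * cosh (a e))"
    by (intro prod.cong) (auto simp: cosh_field_def)
  also have "\<dots> \<le> (\<Prod>e\<in>P. 2 * exp ((a e)\<^sup>2 / 2))"
    by (intro prod_mono conjI mult_left_mono cosh_le_exp_half_square) auto
  also have "\<dots> = 2 ^ card P * exp (\<Sum>e\<in>P. (a e)\<^sup>2 / 2)"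
    using assms by (simp add: prod.distrib exp_sum)
  finally show ?thesis .
qed

text \<open>Rescales a number of successes in \<open>16n\<close> trials: success probability \<open>(4 + v)/8\<close> then gives
  mean \<open>v\<close>, and \<open>v = 0\<close> gives variance \<open>1/n\<close>.\<close>
definition centred_count :: "nat \<Rightarrow> nat \<Rightarrow> real" where
  "centred_count n j = (real j - 8 * real n) / (2 * real n)"

lemma tilted_binomial_mean:
  fixes v :: real
  assumes n: "n > 0"
  shows "(\<Sum>j\<le>16*n. Bernstein (16*n) j ((4 + v) / 8) * centred_count n j) = v"
proof -
  let ?B = "\<lambda>j. Bernstein (16*n) j ((4 + v) / 8)"
  have "(\<Sum>j\<le>16*n. ?B j * centred_count n j) =
    ((\<Sum>j\<le>16*n. real j * ?B j) - 8 * real n * (\<Sum>j\<le>16*n. ?B j)) / (2 * real n)"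
    by (simp add: centred_count_def sum_divide_distrib sum_distrib_left sum_subtractf
        diff_divide_distrib algebra_simps del: sum_Bernstein sum_k_Bernstein)
  also have "\<dots> = v" using n by (simp add: field_simps)
  finally show ?thesis .
qed

lemma tilted_binomial_second_moment:
  fixes v :: real
  assumes n: "n > 0"
  shows "(\<Sum>j\<le>16*n. Bernstein (16*n) j ((4 + v) / 8) * (centred_count n j)\<^sup>2) \<le> v\<^sup>2 + 1 / n"
proof -
  let ?B = "\<lambda>j. Bernstein (16*n) j ((4 + v) / 8)"
  \<comment> \<open>The square is expanded in \<open>j (j - 1)\<close>, \<open>j\<close> and 1,
    whose Bernstein sums are known.\<close>
  have "?B j * (centred_count n j)\<^sup>2 = (real j * (real j - 1) * ?B j +
      ((1 - 16 * real n) * (real j * ?B j) + 64 * (real n)\<^sup>2 * ?B j)) / (4 * (real n)\<^sup>2)" for j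
    using n by (simp add: centred_count_def power2_eq_square field_simps)
  then have "(\<Sum>j\<le>16*n. ?B j * (centred_count n j)\<^sup>2) =
    ((\<Sum>j\<le>16*n. real j * (real j - 1) * ?B j) +
      ((1 - 16 * real n) * (\<Sum>j\<le>16*n. real j * ?B j) + 64 * (real n)\<^sup>2 * (\<Sum>j\<le>16*n. ?B j)))
        / (4 * (real n)\<^sup>2)"
    by (simp add: sum_divide_distrib sum_distrib_left sum.distrib add_divide_distrib
        del: sum_Bernstein sum_k_Bernstein sum_kk_Bernstein)
  \<comment> \<open>The second summand is the binomial variance \<open>16 n p (1 - p)\<close> at
    \<open>p = (4 + v) / 8\<close>, divided by \<open>4 n\<^sup>2\<close>.\<close>
  also have "\<dots> = v\<^sup>2 + (1 - v\<^sup>2 / 16) / n"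
    unfolding sum_Bernstein sum_k_Bernstein sum_kk_Bernstein
    using n by (simp add: field_simps power2_eq_square)
  also have "\<dots> \<le> v\<^sup>2 + 1 / n"
    by (intro add_left_mono divide_right_mono) auto
  finally show ?thesis .
qed

text \<open>Binomial coefficients cancel in the likelihood ratio, so its logarithm is affine in
  \<open>j\<close> and only the mean enters. The constant is slightly above 1/2, the value for a
  Gaussian of variance \<open>1/n\<close> shifted by \<open>v\<close>.\<close>

lemma tilted_binomial_KL:
  fixes v :: real
  assumes v: "\<bar>v\<bar> \<le> 1"
  shows "(\<Sum>j\<le>16*n. Bernstein (16*n) j ((4 + v) / 8) *
      ln (Bernstein (16*n) j ((4 + v) / 8) / Bernstein (16*n) j (1 / 2))) \<le> 25 / 48 * real n * v\<^sup>2"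
proof -
  define b where "b = v / 4"
  let ?m = "16 * n"
  let ?p = "(4 + v) / 8"
  let ?B = "\<lambda>j. Bernstein ?m j ?p"
  have b: "\<bar>b\<bar> \<le> 1 / 4" using v by (simp add: b_def)
  have ln: "ln (?B j / Bernstein ?m j (1 / 2)) =
      real j * ln (1 + b) + (real ?m - real j) * ln (1 - b)" if j: "j \<le> ?m" for j
  proof -
    have "?B j / Bernstein ?m j (1 / 2) = (?p / (1/2)) ^ j * ((1 - ?p) / (1/2)) ^ (?m - j)"
      using j unfolding Bernstein_def power_divide by (simp add: power_one_over)
    also have "\<dots> = (1 + b) ^ j * (1 - b) ^ (?m - j)"
      by (intro arg_cong2[where f = "\<lambda>x y. x ^ j * y ^ (?m - j)"]) (simp_all add: b_def field_simps)
    finally have "?B j / Bernstein ?m j (1 / 2) = (1 + b) ^ j * (1 - b) ^ (?m - j)" .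
    moreover have "1 + b > 0" "1 - b > 0" using b by auto
    ultimately show ?thesis using j
      by (simp add: ln_mult ln_realpow of_nat_diff)
  qed
  have "(\<Sum>j\<le>?m. ?B j * ln (?B j / Bernstein ?m j (1 / 2))) =
     (\<Sum>j\<le>?m. (ln (1 + b) - ln (1 - b)) * (real j * ?B j) + real ?m * ln (1 - b) * ?B j)"
    by (intro sum.cong refl, subst ln) (simp_all add: algebra_simps)
  also have "\<dots> = (ln (1 + b) - ln (1 - b)) * (real ?m * ?p) + real ?m * ln (1 - b)"
    by (simp add: sum.distrib flip: sum_distrib_left)
  also have "\<dots> = 8 * real n * ((1 + b) * ln (1 + b) + (1 - b) * ln (1 + - b))"
    by (simp add: b_def field_simps)
  \<comment> \<open>The two cubic bounds, at \<open>b\<close> and \<open>- b\<close>, combine into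
    an even polynomial. With \<open>b\<^sup>2 \<le> 1/16\<close> the constant becomes
    \<open>8/16 * (1 + 1/24) = 25/48\<close>.\<close>
  also have "\<dots> \<le> 8 * real n * ((1 + b) * (b - b^2/2 + b^3/3) + (1 - b) * (- b - (- b)^2/2 + (- b)^3/3))"
    using b by (intro mult_left_mono add_mono ln_one_plus_le_cubic) auto
  also have "\<dots> = 8 * real n * (b\<^sup>2 * (1 + 2/3 * b\<^sup>2))"
    by (simp add: power2_eq_square power3_eq_cube field_simps)
  also have "\<dots> \<le> 8 * real n * (b\<^sup>2 * (1 + 2/3 * (1/4)\<^sup>2))"
    using b abs_le_square_iff[of b "1/4"] by (intro mult_left_mono add_mono) auto
  also have "\<dots> = 25 / 48 * real n * v\<^sup>2"
    by (simp add: b_def power2_eq_square)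
  finally show ?thesis .
qed

text \<open>The prior puts independent binomial coordinates on the test vector; the posterior tilts
  coordinate \<open>i\<close> to have mean \<open>w i\<close>. Since the form has no diagonal terms, independence makes its
  posterior expectation equal to its value at \<open>w\<close>.\<close>
lemma exp_quadratic_form_le_prior_average:
  fixes s :: "'a \<Rightarrow> 'a \<Rightarrow> real" and w :: "'a \<Rightarrow> real"
  assumes V: "finite V" "card V = n" "n > 0" and w: "(\<Sum>i\<in>V. (w i)\<^sup>2) = 1"
  shows "exp (t * (\<Sum>i\<in>V. \<Sum>j\<in>V-{i}. s i j * (w i * w j)) - 4 * t\<^sup>2 - 25 / 48 * real n) \<le>
    (\<Sum>c\<in>PiE V (\<lambda>_. {..16*n}). (\<Prod>i\<in>V. Bernstein (16*n) (c i) (1 / 2)) *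
       exp (t * (\<Sum>i\<in>V. \<Sum>j\<in>V-{i}. s i j * (centred_count n (c i) * centred_count n (c j))) -
            t\<^sup>2 * (\<Sum>i\<in>V. \<Sum>j\<in>V-{i}. (centred_count n (c i))\<^sup>2 * (centred_count n (c j))\<^sup>2)))"
proof -
  let ?Y = "{..16*n}"
  let ?C = "PiE V (\<lambda>_. ?Y)"
  let ?X = "centred_count n"
  define q where "q i y = Bernstein (16*n) y ((4 + w i) / 8)" for i y
  define r where "r y = Bernstein (16*n) y (1 / 2)" for y
  define Q where "Q c = (\<Prod>i\<in>V. q i (c i))" for c
  define R where "R c = (\<Prod>i\<in>V. r (c i))" for c
  define F where "F c = t * (\<Sum>i\<in>V. \<Sum>j\<in>V-{i}. s i j * (?X (c i) * ?X (c j))) -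
            t\<^sup>2 * (\<Sum>i\<in>V. \<Sum>j\<in>V-{i}. (?X (c i))\<^sup>2 * (?X (c j))\<^sup>2)" for c
  \<comment> \<open>This keeps the success probabilities \<open>(4 + w i) / 8\<close> between 3/8
    and 5/8, so all posterior weights are positive and the entropy bound applies.\<close>
  have w1: "\<bar>w i\<bar> \<le> 1" if "i \<in> V" for i
  proof -
    have "(w i)\<^sup>2 \<le> (\<Sum>i\<in>V. (w i)\<^sup>2)" using that V by (intro member_le_sum) auto
    then show ?thesis using w by (simp add: abs_square_le_1)
  qed
  have qpos: "q i y > 0" if "i \<in> V" "y \<in> ?Y" for i y
    unfolding q_def using w1[OF that(1)] that by (intro Bernstein_pos) auto
  have rpos: "r y > 0" if "y \<in> ?Y" for y
    unfolding r_def using that by (intro Bernstein_pos) auto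
  have Qpos: "Q c > 0" if "c \<in> ?C" for c
    unfolding Q_def using that by (intro prod_pos qpos) auto
  have Rpos: "R c > 0" if "c \<in> ?C" for c
    unfolding R_def using that by (intro prod_pos rpos) auto
  have q1: "sum (q i) ?Y = 1" for i by (simp add: q_def)
  note marg = product_weights_marginal[of V ?Y q, OF V(1) _ q1, folded Q_def, simplified]
  note marg2 = product_weights_two_marginals[of V ?Y q, OF V(1) _ q1, folded Q_def, simplified]
  have Q1: "sum Q ?C = 1"
    using product_weights_total[of V ?Y q, OF V(1) _ q1] by (simp add: Q_def)
  define M where "M i = (\<Sum>y\<in>?Y. q i y * (?X y)\<^sup>2)" for i
  have M: "0 \<le> M i" "M i \<le> (w i)\<^sup>2 + 1 / n" if "i \<in> V" for i
    using tilted_binomial_second_moment[OF V(3), of "w i"] less_imp_le[OF qpos[OF that]]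
    by (auto simp: M_def q_def intro!: sum_nonneg mult_nonneg_nonneg)
  \<comment> \<open>The squared means sum to 1, and the \<open>n\<close> variances of at most
    \<open>1/n\<close> contribute at most 1 more.\<close>
  have Msum: "(\<Sum>i\<in>V. M i) \<le> 2"
  proof -
    have "(\<Sum>i\<in>V. M i) \<le> (\<Sum>i\<in>V. (w i)\<^sup>2 + 1 / n)" using M by (intro sum_mono)
    then show ?thesis using w V by (simp add: sum.distrib)
  qed
  have ef: "(\<Sum>c\<in>?C. Q c * (\<Sum>i\<in>V. \<Sum>j\<in>V-{i}. s i j * (?X (c i) * ?X (c j)))) =
      (\<Sum>i\<in>V. \<Sum>j\<in>V-{i}. s i j * (w i * w j))"
  proof -
    have "(\<Sum>c\<in>?C. Q c * (\<Sum>i\<in>V. \<Sum>j\<in>V-{i}. s i j * (?X (c i) * ?X (c j)))) =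
      (\<Sum>i\<in>V. \<Sum>j\<in>V-{i}. \<Sum>c\<in>?C. s i j * (Q c * (?X (c i) * ?X (c j))))"
      unfolding sum_distrib_left
      by (subst sum.swap, intro sum.cong refl, subst sum.swap) (simp add: algebra_simps)
    also have "\<dots> = (\<Sum>i\<in>V. \<Sum>j\<in>V-{i}. s i j * (\<Sum>c\<in>?C. Q c * (?X (c i) * ?X (c j))))"
      by (simp add: sum_distrib_left)
    also have "\<dots> = (\<Sum>i\<in>V. \<Sum>j\<in>V-{i}. s i j * (w i * w j))"
      by (intro sum.cong refl arg_cong2[where f = "(*)"], subst marg2)
         (auto simp: q_def tilted_binomial_mean[OF V(3)])
    finally show ?thesis .
  qed
  \<comment> \<open>Off the diagonal the second moments multiply. Adding the nonnegative diagonal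
    terms completes the square of \<open>\<Sum>i\<in>V. M i\<close>.\<close>
  have ep: "(\<Sum>c\<in>?C. Q c * (\<Sum>i\<in>V. \<Sum>j\<in>V-{i}. (?X (c i))\<^sup>2 * (?X (c j))\<^sup>2)) \<le> 4"
  proof -
    have "(\<Sum>c\<in>?C. Q c * (\<Sum>i\<in>V. \<Sum>j\<in>V-{i}. (?X (c i))\<^sup>2 * (?X (c j))\<^sup>2)) =
      (\<Sum>i\<in>V. \<Sum>j\<in>V-{i}. \<Sum>c\<in>?C. Q c * ((?X (c i))\<^sup>2 * (?X (c j))\<^sup>2))"
      unfolding sum_distrib_left
      by (subst sum.swap, intro sum.cong refl, subst sum.swap) (simp add: algebra_simps)
    also have "\<dots> = (\<Sum>i\<in>V. \<Sum>j\<in>V-{i}. M i * M j)"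
      by (intro sum.cong refl, subst marg2[where f = "\<lambda>y. (?X y)\<^sup>2" and g = "\<lambda>y. (?X y)\<^sup>2"])
         (auto simp: M_def)
    also have "\<dots> \<le> (\<Sum>i\<in>V. \<Sum>j\<in>V. M i * M j)"
      using V M by (intro sum_mono sum_mono2) auto
    also have "\<dots> = (\<Sum>i\<in>V. M i)\<^sup>2"
      by (simp add: power2_eq_square sum_product)
    also have "\<dots> \<le> 2\<^sup>2"
      using Msum M by (intro power_mono sum_nonneg) auto
    finally show ?thesis by simp
  qed
  \<comment> \<open>Relative entropy is additive over product measures, so the coordinate bounds add
    up to a multiple of the squared norm of \<open>w\<close>.\<close>
  have kl: "(\<Sum>c\<in>?C. Q c * ln (Q c / R c)) \<le> 25 / 48 * real n"
  proof -
    have "Q c * ln (Q c / R c) = (\<Sum>i\<in>V. Q c * ln (q i (c i) / r (c i)))" if c: "c \<in> ?C" for c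
    proof -
      have "Q c / R c = (\<Prod>i\<in>V. q i (c i) / r (c i))"
        by (simp add: Q_def R_def prod_dividef)
      moreover have "q i (c i) / r (c i) > 0" if "i \<in> V" for i
        using that c qpos[of i "c i"] rpos[of "c i"] by (auto simp: PiE_def Pi_def)
      then have "q i (c i) / r (c i) \<noteq> 0" if "i \<in> V" for i
        using that by (metis less_irrefl)
      ultimately have "ln (Q c / R c) = (\<Sum>i\<in>V. ln (q i (c i) / r (c i)))"
        using ln_prod[OF V(1), of "\<lambda>i. q i (c i) / r (c i)"] by simp
      then show ?thesis by (simp add: sum_distrib_left)
    qed
    then have "(\<Sum>c\<in>?C. Q c * ln (Q c / R c)) = (\<Sum>i\<in>V. \<Sum>c\<in>?C. Q c * ln (q i (c i) / r (c i)))"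
      by (subst sum.swap) (intro sum.cong refl)
    also have "\<dots> = (\<Sum>i\<in>V. \<Sum>y\<in>?Y. q i y * ln (q i y / r y))"
      by (intro sum.cong refl) (rule marg, auto)
    also have "\<dots> \<le> (\<Sum>i\<in>V. 25 / 48 * real n * (w i)\<^sup>2)"
      unfolding q_def r_def by (intro sum_mono tilted_binomial_KL w1)
    also have "\<dots> = 25 / 48 * real n" using w unfolding sum_distrib_left[symmetric] by simp
    finally show ?thesis .
  qed
  have "(\<Sum>c\<in>?C. Q c * (F c - ln (Q c / R c))) =
      t * (\<Sum>c\<in>?C. Q c * (\<Sum>i\<in>V. \<Sum>j\<in>V-{i}. s i j * (?X (c i) * ?X (c j)))) -
      t\<^sup>2 * (\<Sum>c\<in>?C. Q c * (\<Sum>i\<in>V. \<Sum>j\<in>V-{i}. (?X (c i))\<^sup>2 * (?X (c j))\<^sup>2)) -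
      (\<Sum>c\<in>?C. Q c * ln (Q c / R c))"
    unfolding sum_distrib_left[of t] sum_distrib_left[of "t\<^sup>2"] sum_subtractf[symmetric]
    by (intro sum.cong refl) (simp add: F_def algebra_simps sum_distrib_left)
  also have "\<dots> \<ge> t * (\<Sum>i\<in>V. \<Sum>j\<in>V-{i}. s i j * (w i * w j)) - t\<^sup>2 * 4 - 25 / 48 * real n"
    unfolding ef using ep kl by (intro diff_mono mult_left_mono order_refl) auto
  finally have "exp (t * (\<Sum>i\<in>V. \<Sum>j\<in>V-{i}. s i j * (w i * w j)) - 4 * t\<^sup>2 - 25 / 48 * real n)
      \<le> exp (\<Sum>c\<in>?C. Q c * (F c - ln (Q c / R c)))"
    by (simp add: mult.commute)
  also have "\<dots> \<le> (\<Sum>c\<in>?C. R c * exp (F c))"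
    by (intro exp_expectation_minus_KL_le Qpos Rpos Q1)
  finally show ?thesis unfolding R_def F_def r_def .
qed

section \<open>Signed adjacency matrices\<close>

definition all_edges :: "'a set \<Rightarrow> 'a set set" where
  "all_edges V = {e. e \<subseteq> V \<and> card e = 2}"

lemma finite_all_edges: "finite V \<Longrightarrow> finite (all_edges V)"
  unfolding all_edges_def by (rule finite_subset[of _ "Pow V"]) auto

text \<open>Ordered pairs are grouped by their underlying edge; each edge comes from exactly two of
  them.\<close>

lemma sum_ordered_pairs:
  fixes f :: "'a set \<Rightarrow> real"
  assumes V: "finite V"
  shows "(\<Sum>i\<in>V. \<Sum>j\<in>V-{i}. f {i, j}) = 2 * (\<Sum>e\<in>all_edges V. f e)"
proof -
  let ?S = "Sigma V (\<lambda>i. V - {i})"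
  let ?g = "\<lambda>p. {fst p, snd p}"
  have "(\<Sum>i\<in>V. \<Sum>j\<in>V-{i}. f {i, j}) = (\<Sum>p\<in>?S. f (?g p))"
    using V by (subst sum.Sigma) (auto simp: case_prod_unfold)
  also have "\<dots> = (\<Sum>e\<in>all_edges V. \<Sum>p | p \<in> ?S \<and> ?g p = e. f (?g p))"
    by (rule sum.group[symmetric]) (use V in \<open>auto simp: finite_all_edges, auto simp: all_edges_def card_2_iff\<close>)
  also have "\<dots> = (\<Sum>e\<in>all_edges V. 2 * f e)"
  proof (rule sum.cong)
    fix e assume "e \<in> all_edges V"
    then obtain a b where ab: "e = {a, b}" "a \<noteq> b" "a \<in> V" "b \<in> V"
      unfolding all_edges_def card_2_iff by auto
    then have "{p. p \<in> ?S \<and> ?g p = e} = {(a, b), (b, a)}"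
      by (auto simp: doubleton_eq_iff)
    then show "(\<Sum>p | p \<in> ?S \<and> ?g p = e. f (?g p)) = 2 * f e"
      using ab by (simp add: insert_commute)
  qed simp
  finally show ?thesis by (simp add: sum_distrib_left)
qed

lemma signed_adjacency_carrier: "signed_adjacency n E \<in> carrier_mat n n"
  by (simp add: signed_adjacency_def)

lemma signed_adjacency_symmetric: "(signed_adjacency n E)\<^sup>T = signed_adjacency n E"
  by (intro eq_matI) (auto simp: signed_adjacency_def insert_commute)

lemma scalar_prod_vec_eq_sum:
  fixes y :: "nat \<Rightarrow> real"
  shows "vec n (\<lambda>i. y (i + 1)) \<bullet> vec n (\<lambda>i. y (i + 1)) = (\<Sum>i\<in>{1..n}. (y i)\<^sup>2)"
  unfolding scalar_prod_def
  by (rule sum.reindex_bij_witness[of _ "\<lambda>i. i - 1" "\<lambda>i. i + 1"]) (auto simp: power2_eq_square)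

lemma signed_adjacency_quadratic_form:
  fixes y :: "nat \<Rightarrow> real"
  shows "vec n (\<lambda>i. y (i + 1)) \<bullet> (signed_adjacency n E *\<^sub>v vec n (\<lambda>i. y (i + 1))) =
    (\<Sum>i\<in>{1..n}. \<Sum>j\<in>{1..n}-{i}. (if {i, j} \<in> E then 1 else - 1) * (y i * y j))"
proof -
  define h where "h i j = (if i = j then 0 else if {i, j} \<in> E then 1 else - 1) * (y i * y j)" for i j
  have shift: "(\<Sum>i<n. g (i + 1)) = (\<Sum>i\<in>{1..n}. g i)" for g :: "nat \<Rightarrow> real"
    by (rule sum.reindex_bij_witness[of _ "\<lambda>i. i - 1" "\<lambda>i. i + 1"]) auto
  have "vec n (\<lambda>i. y (i + 1)) \<bullet> (signed_adjacency n E *\<^sub>v vec n (\<lambda>i. y (i + 1))) =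
      (\<Sum>i<n. \<Sum>j<n. h (i + 1) (j + 1))"
    by (auto simp: scalar_prod_def signed_adjacency_def h_def sum_distrib_left atLeast0LessThan
        intro!: sum.cong)
  also have "\<dots> = (\<Sum>i\<in>{1..n}. \<Sum>j\<in>{1..n}. h i j)"
    unfolding shift[where g = "\<lambda>j. h _ j"] by (rule shift)
  also have "\<dots> = (\<Sum>i\<in>{1..n}. \<Sum>j\<in>{1..n}-{i}. h i j)"
    by (intro sum.cong refl sum.mono_neutral_right) (auto simp: h_def)
  also have "\<dots> = (\<Sum>i\<in>{1..n}. \<Sum>j\<in>{1..n}-{i}. (if {i, j} \<in> E then 1 else - 1) * (y i * y j))"
    by (intro sum.cong refl) (auto simp: h_def)
  finally show ?thesis .
qed

text \<open>Passing to one term per edge matters because the signs of different edges are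
  independent, whereas \<open>(i, j)\<close> and \<open>(j, i)\<close> share a sign.\<close>

lemma sum_pairs_products:
  fixes y :: "'a \<Rightarrow> real"
  assumes "finite V"
  shows "(\<Sum>i\<in>V. \<Sum>j\<in>V-{i}. f {i, j} * (y i * y j)) = 2 * (\<Sum>e\<in>all_edges V. f e * (\<Prod>u\<in>e. y u))"
proof -
  have "(\<Sum>i\<in>V. \<Sum>j\<in>V-{i}. f {i, j} * (y i * y j)) = (\<Sum>i\<in>V. \<Sum>j\<in>V-{i}. f {i, j} * (\<Prod>u\<in>{i, j}. y u))"
    by (intro sum.cong refl) auto
  then show ?thesis using sum_ordered_pairs[OF assms] by simp
qed

section \<open>Correctness of the certificates\<close>

text \<open>The Rayleigh bound at the indicator vector of \<open>W\<close>: the form is twice the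
  number of edges minus non-edges inside \<open>W\<close>, and the squared norm is
  \<open>card W\<close>. Not dividing by \<open>card W\<close> lets \<open>W\<close> be
  empty.\<close>

lemma largest_eigenvalue_signed_adjacency_ge:
  assumes n: "n \<ge> 1" and E: "E \<in> graphs_on {1..n}" and W: "W \<subseteq> {1..n}"
  shows "4 * real (card (induced_edges E W)) - real (card W) * (real (card W) - 1) \<le>
    largest_eigenvalue (signed_adjacency n E) * real (card W)"
proof -
  define y :: "nat \<Rightarrow> real" where "y i = (if i \<in> W then 1 else 0)" for i
  let ?x = "vec n (\<lambda>i. y (i + 1))"
  let ?f = "\<lambda>e. (if e \<in> E then 1 else - 1) :: real"
  have finW: "finite W" using W finite_subset by blast
  have fin: "finite (all_edges W)" using finite_all_edges[OF finW] .
  have "?x \<bullet> (signed_adjacency n E *\<^sub>v ?x) = 2 * (\<Sum>e\<in>all_edges {1..n}. ?f e * (\<Prod>u\<in>e. y u))"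
    unfolding signed_adjacency_quadratic_form by (rule sum_pairs_products) simp
  also have "(\<Sum>e\<in>all_edges {1..n}. ?f e * (\<Prod>u\<in>e. y u)) = (\<Sum>e\<in>all_edges W. ?f e)"
  proof (rule sum.mono_neutral_cong_right)
    show "finite (all_edges {1..n})" by (simp add: finite_all_edges)
    show "all_edges W \<subseteq> all_edges {1..n}" using W by (auto simp: all_edges_def)
    show "\<forall>e\<in>all_edges {1..n} - all_edges W. ?f e * (\<Prod>u\<in>e. y u) = 0"
    proof
      fix e assume e: "e \<in> all_edges {1..n} - all_edges W"
      then have "finite e" "\<exists>u\<in>e. y u = 0"
        by (auto simp: all_edges_def y_def card_ge_0_finite)
      then show "?f e * (\<Prod>u\<in>e. y u) = 0" by simp
    qed
    show "?f e * (\<Prod>u\<in>e. y u) = ?f e" if "e \<in> all_edges W" for e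
    proof -
      have "(\<Prod>u\<in>e. y u) = (\<Prod>u\<in>e. 1)"
        using that by (intro prod.cong) (auto simp: all_edges_def y_def)
      then show ?thesis by simp
    qed
  qed
  also have "(\<Sum>e\<in>all_edges W. ?f e) = (\<Sum>e\<in>all_edges W. 2 * (if e \<in> E then 1 else 0) - 1)"
    by (intro sum.cong) auto
  also have "\<dots> = 2 * real (card (all_edges W \<inter> E)) - real (card (all_edges W))"
    using fin by (simp add: sum_subtractf sum.If_cases flip: sum_distrib_left)
  also have "all_edges W \<inter> E = induced_edges E W"
    using E by (auto simp: all_edges_def induced_edges_def graphs_on_def)
  also have "card (all_edges W) = card W choose 2"
    unfolding all_edges_def by (rule n_subsets[OF finW])
  also have "real (card W choose 2) = real (card W) * (real (card W) - 1) / 2"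
    by (cases "card W") (auto simp: choose_two real_of_nat_div algebra_simps)
  finally have "?x \<bullet> (signed_adjacency n E *\<^sub>v ?x) =
      4 * real (card (induced_edges E W)) - real (card W) * (real (card W) - 1)"
    by simp
  moreover have "?x \<bullet> ?x = real (card W)"
  proof -
    have "?x \<bullet> ?x = (\<Sum>i\<in>{1..n}. if i \<in> W then 1 else 0)"
      unfolding scalar_prod_vec_eq_sum by (intro sum.cong) (auto simp: y_def)
    also have "\<dots> = real (card ({1..n} \<inter> W))" by (simp add: sum.If_cases)
    finally show ?thesis using W by (simp add: Int_absorb1)
  qed
  ultimately show ?thesis
    using quadratic_form_le_largest_eigenvalue(2)[OF signed_adjacency_carrier
        signed_adjacency_symmetric, of n ?x E] n by simp
qed

text \<open>Excess \<open>eps\<close> makes the form at the indicator vector at least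
  \<open>2 * eps * k * (k - 1)\<close>; dividing by the squared norm \<open>k\<close> contradicts
  the certificate.\<close>

lemma spectral_certificate_correct:
  assumes n: "n \<ge> 1" and E: "E \<in> graphs_on {1..n}" and cert: "(k, eps) \<in> spectrally_certified n E"
  shows "\<not> contains_subgraph_with_excess {1..n} E k eps"
proof
  let ?l = "largest_eigenvalue (signed_adjacency n E)"
  assume "contains_subgraph_with_excess {1..n} E k eps"
  then obtain W where W: "W \<subseteq> {1..n}" "card W = k"
    and dens: "real (card (induced_edges E W)) \<ge> (1 / 2 + eps) * real k * (real k - 1) / 2"
    unfolding contains_subgraph_with_excess_def has_excess_def has_density_def by auto
  have eps: "eps \<ge> 0" and l: "?l < 2 * eps * (real k - 1)"
    using cert by (auto simp: spectrally_certified_def)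
  \<comment> \<open>A single vertex gives a nonnegative eigenvalue bound. This excludes
    \<open>k = 0\<close>, where the density condition is vacuous and the factor
    \<open>real k - 1\<close> is \<open>-1\<close>.\<close>
  have "?l \<ge> 0"
  proof -
    have "0 \<le> 4 * real (card (induced_edges E {1})) - real (card {1::nat}) * (real (card {1::nat}) - 1)"
      by simp
    also have "\<dots> \<le> ?l" using largest_eigenvalue_signed_adjacency_ge[OF n E, of "{1}"] n by simp
    finally show ?thesis .
  qed
  then have k: "k > 0" using l eps by (cases k) auto
  have "(2 * eps * (real k - 1)) * real k \<le>
      4 * real (card (induced_edges E W)) - real k * (real k - 1)"
    using dens by (simp add: field_simps)
  also have "\<dots> \<le> ?l * real k"
    using largest_eigenvalue_signed_adjacency_ge[OF n E W(1)] W(2) by simp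
  finally have "2 * eps * (real k - 1) \<le> ?l" using k by simp
  then show False using l by simp
qed

section \<open>Large eigenvalues are rare among all graphs\<close>

lemma graphs_on_eq: "graphs_on V = Pow (all_edges V)"
  by (simp add: graphs_on_def all_edges_def)

lemma unit_top_eigenvector:
  assumes n: "n \<ge> 1"
  obtains w where "(\<Sum>i\<in>{1..n}. (w i)\<^sup>2) = 1"
    "(\<Sum>i\<in>{1..n}. \<Sum>j\<in>{1..n}-{i}. (if {i, j} \<in> E then 1 else - 1) * (w i * w j)) =
      largest_eigenvalue (signed_adjacency n E)"
proof -
  let ?A = "signed_adjacency n E"
  let ?l = "largest_eigenvalue ?A"
  note A = signed_adjacency_carrier[of n E]
  have "?l \<in> spectrum ?A"
    using quadratic_form_le_largest_eigenvalue(1)[OF A signed_adjacency_symmetric] n by simp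
  then obtain v where v: "v \<in> carrier_vec n" "v \<noteq> 0\<^sub>v n" "?A *\<^sub>v v = ?l \<cdot>\<^sub>v v"
    using A by (auto simp: spectrum_def eigenvalue_def eigenvector_def)
  have pos: "v \<bullet> v > 0"
    using v scalar_prod_self_eq_0_iff scalar_prod_self_nonneg[of v] by (metis less_eq_real_def)
  define c where "c = 1 / sqrt (v \<bullet> v)"
  \<comment> \<open>Vertex \<open>i\<close> reads vector entry \<open>i - 1\<close>; the truncated
    value at \<open>i = 0\<close> never enters, since the sums start at 1.\<close>
  define w where "w i = c * v $ (i - 1)" for i
  have cc: "c * c * (v \<bullet> v) = 1" using pos by (simp add: c_def)
  have wv: "vec n (\<lambda>i. w (i + 1)) = c \<cdot>\<^sub>v v"
    using v by (intro eq_vecI) (auto simp: w_def)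
  show ?thesis
  proof
    show "(\<Sum>i\<in>{1..n}. (w i)\<^sup>2) = 1"
      unfolding scalar_prod_vec_eq_sum[symmetric] wv using v cc by simp
    show "(\<Sum>i\<in>{1..n}. \<Sum>j\<in>{1..n}-{i}. (if {i, j} \<in> E then 1 else - 1) * (w i * w j)) = ?l"
      unfolding signed_adjacency_quadratic_form[symmetric] wv
      using v cc A by (simp add: mult_mat_vec[of _ n n] mult.assoc mult.left_commute)
  qed
qed

text \<open>Markov's inequality for \<open>Phi\<close>, which is at least
  \<open>exp (n / 24)\<close> on every bad graph and has average at most 1 over all graphs.\<close>

lemma card_large_eigenvalue_le:
  assumes n: "n \<ge> 1"
  shows "real (card {E \<in> graphs_on {1..n}. largest_eigenvalue (signed_adjacency n E) \<ge> 3 * sqrt n}) \<le>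
    exp (- real n / 24) * real (card (graphs_on {1..n}))"
proof -
  let ?V = "{1..n}"
  let ?P = "all_edges ?V"
  let ?C = "PiE ?V (\<lambda>_. {..16*n})"
  let ?X = "centred_count n"
  let ?B = "{E \<in> graphs_on ?V. largest_eigenvalue (signed_adjacency n E) \<ge> 3 * sqrt n}"
  \<comment> \<open>This \<open>t\<close> maximises \<open>3 * sqrt n * t - 4 * t\<^sup>2\<close>,
    with value \<open>9/16 * n\<close>; subtracting the entropy cost \<open>25/48 * n\<close> leaves
    \<open>n / 24\<close>.\<close>
  define t where "t = 3 / 8 * sqrt n"
  define s :: "nat set set \<Rightarrow> nat set \<Rightarrow> real" where "s E e = (if e \<in> E then 1 else - 1)" for E e
  define R where "R c = (\<Prod>i\<in>?V. Bernstein (16*n) (c i) (1 / 2))" for c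
  define pen where "pen c = t\<^sup>2 * (\<Sum>i\<in>?V. \<Sum>j\<in>?V-{i}. (?X (c i))\<^sup>2 * (?X (c j))\<^sup>2)" for c
  define Q where "Q E c = t * (\<Sum>i\<in>?V. \<Sum>j\<in>?V-{i}. s E {i, j} * (?X (c i) * ?X (c j)))" for E c
  define Phi where "Phi E = (\<Sum>c\<in>?C. R c * exp (Q E c - pen c))" for E
  have finP: "finite ?P" by (simp add: finite_all_edges)
  have R0: "R c \<ge> 0" for c
    unfolding R_def by (intro prod_nonneg Bernstein_nonneg ballI) auto
  have R1: "sum R ?C = 1"
    unfolding R_def by (rule product_weights_total) auto
  have Phi0: "Phi E \<ge> 0" for E
    unfolding Phi_def using R0 by (intro sum_nonneg mult_nonneg_nonneg) auto
  have big: "exp (real n / 24) \<le> Phi E" if E: "E \<in> ?B" for E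
  proof -
    let ?l = "largest_eigenvalue (signed_adjacency n E)"
    obtain w where w: "(\<Sum>i\<in>?V. (w i)\<^sup>2) = 1"
      "(\<Sum>i\<in>?V. \<Sum>j\<in>?V-{i}. s E {i, j} * (w i * w j)) = ?l"
      using unit_top_eigenvector[OF n] unfolding s_def by blast
    have "t * ?l \<ge> t * (3 * sqrt n)"
      using E by (intro mult_left_mono) (auto simp: t_def)
    moreover have "t * (3 * sqrt n) = 9 / 8 * real n" by (simp add: t_def)
    moreover have "t\<^sup>2 = 9 / 64 * real n" by (simp add: t_def power_mult_distrib power_divide)
    ultimately have "exp (real n / 24) \<le> exp (t * ?l - 4 * t\<^sup>2 - 25 / 48 * real n)" by simp
    also have "\<dots> \<le> Phi E"
      unfolding Phi_def R_def Q_def pen_def w(2)[symmetric]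
      by (rule exp_quadratic_form_le_prior_average) (use n w in auto)
    finally show ?thesis .
  qed
  have average: "(\<Sum>E\<in>Pow ?P. exp (Q E c - pen c)) \<le> 2 ^ card ?P" for c
  proof -
    \<comment> \<open>The factor 2 counts both orders of an edge. It also makes
      \<open>(a e)\<^sup>2 / 2\<close> sum to \<open>pen c\<close>, so the penalty cancels the
      exponential moment bound exactly.\<close>
    define a where "a e = 2 * t * (\<Prod>u\<in>e. ?X (c u))" for e
    have "Q E c = (\<Sum>e\<in>?P. s E e * a e)" for E
    proof -
      have "Q E c = t * (2 * (\<Sum>e\<in>?P. s E e * (\<Prod>u\<in>e. ?X (c u))))"
        unfolding Q_def by (subst sum_pairs_products[of _ "s E"]) auto
      then show ?thesis by (simp add: a_def sum_distrib_left algebra_simps)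
    qed
    moreover have "pen c = (\<Sum>e\<in>?P. (a e)\<^sup>2 / 2)"
    proof -
      have "pen c = t\<^sup>2 * (2 * (\<Sum>e\<in>?P. \<Prod>u\<in>e. (?X (c u))\<^sup>2))"
        unfolding pen_def using sum_pairs_products[of ?V "\<lambda>_. 1" "\<lambda>u. (?X (c u))\<^sup>2"] by simp
      then show ?thesis
        by (simp add: a_def sum_distrib_left power_mult_distrib algebra_simps flip: prod_power_distrib)
    qed
    ultimately have "(\<Sum>E\<in>Pow ?P. exp (Q E c - pen c)) =
        (\<Sum>E\<in>Pow ?P. exp (\<Sum>e\<in>?P. s E e * a e)) * exp (- (\<Sum>e\<in>?P. (a e)\<^sup>2 / 2))"
      by (simp add: sum_distrib_right flip: exp_add)
    also have "\<dots> \<le> (2 ^ card ?P * exp (\<Sum>e\<in>?P. (a e)\<^sup>2 / 2)) * exp (- (\<Sum>e\<in>?P. (a e)\<^sup>2 / 2))"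
      unfolding s_def by (intro mult_right_mono sum_Pow_exp_signed_sum_le finP) auto
    also have "\<dots> = 2 ^ card ?P" by (simp add: mult.assoc flip: exp_add)
    finally show ?thesis .
  qed
  have "real (card ?B) * exp (real n / 24) = (\<Sum>E\<in>?B. exp (real n / 24))" by simp
  also have "\<dots> \<le> (\<Sum>E\<in>?B. Phi E)" by (intro sum_mono big)
  also have "\<dots> \<le> (\<Sum>E\<in>Pow ?P. Phi E)"
    using finP Phi0 by (intro sum_mono2) (auto simp: graphs_on_eq)
  \<comment> \<open>After the swap the test vector is fixed while the graph varies, as the sign
    bound requires.\<close>
  also have "\<dots> = (\<Sum>c\<in>?C. R c * (\<Sum>E\<in>Pow ?P. exp (Q E c - pen c)))"
    unfolding Phi_def sum_distrib_left by (rule sum.swap)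
  also have "\<dots> \<le> (\<Sum>c\<in>?C. R c * 2 ^ card ?P)"
    by (intro sum_mono mult_left_mono average R0)
  also have "\<dots> = real (card (graphs_on ?V))"
    using R1 finP by (simp add: graphs_on_eq card_Pow flip: sum_distrib_right)
  finally show ?thesis by (simp add: exp_minus field_simps)
qed

theorem theorem3:
  shows "(\<forall>n\<ge>1. \<forall>E \<in> graphs_on {1..n}. \<forall>(k, eps) \<in> spectrally_certified n E.
            \<not> contains_subgraph_with_excess {1..n} E k eps)
       \<and> (\<lambda>n. real (card {E \<in> graphs_on {1..n}.
                 \<forall>(k::nat) (eps::real). eps \<ge> 0 \<and> 2 * eps * (real k - 1) \<ge> 3 * sqrt (real n)
                   \<longrightarrow> (k, eps) \<in> spectrally_certified n E})
              / real (card (graphs_on {1..n}))) \<longlonglongrightarrow> 1"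
proof (intro conjI)
  show "\<forall>n\<ge>1. \<forall>E \<in> graphs_on {1..n}. \<forall>(k, eps) \<in> spectrally_certified n E.
            \<not> contains_subgraph_with_excess {1..n} E k eps"
    using spectral_certificate_correct by blast
next
  let ?G = "\<lambda>n. {E \<in> graphs_on {1..n}.
                 \<forall>(k::nat) (eps::real). eps \<ge> 0 \<and> 2 * eps * (real k - 1) \<ge> 3 * sqrt (real n)
                   \<longrightarrow> (k, eps) \<in> spectrally_certified n E}"
  let ?r = "\<lambda>n. real (card (?G n)) / real (card (graphs_on {1..n}))"
  have fin: "finite (graphs_on {1..n})" for n :: nat
    by (simp add: graphs_on_eq finite_all_edges)
  have pos: "card (graphs_on {1..n}) > 0" for n :: nat
    using fin[of n] by (auto simp: card_gt_0_iff graphs_on_def)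
  have upper: "?r n \<le> 1" for n
    using card_mono[OF fin, of "?G n" n] pos[of n] by (simp add: divide_le_eq_1)
  \<comment> \<open>The case \<open>n = 0\<close> is left out: the empty matrix has no eigenvalue,
    and the limit does not see it.\<close>
  have lower: "1 - exp (- real n / 24) \<le> ?r n" if n: "n \<ge> 1" for n
  proof -
    let ?B = "{E \<in> graphs_on {1..n}. largest_eigenvalue (signed_adjacency n E) \<ge> 3 * sqrt n}"
    \<comment> \<open>Outside \<open>?B\<close> the eigenvalue is strictly below
      \<open>3 * sqrt n\<close>, so the weak inequality on \<open>(k, eps)\<close> yields the strict
      one of a certificate, for all pairs at once.\<close>
    have "graphs_on {1..n} - ?B \<subseteq> ?G n"
      by (auto simp: spectrally_certified_def)
    then have "card (graphs_on {1..n} - ?B) \<le> card (?G n)"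
      using fin by (intro card_mono) auto
    moreover have "card (graphs_on {1..n} - ?B) = card (graphs_on {1..n}) - card ?B"
      using fin by (intro card_Diff_subset) auto
    moreover have "card ?B \<le> card (graphs_on {1..n})"
      using fin by (intro card_mono) auto
    ultimately have "real (card (graphs_on {1..n})) - real (card ?B) \<le> real (card (?G n))" by simp
    then have "(1 - exp (- real n / 24)) * real (card (graphs_on {1..n})) \<le> real (card (?G n))"
      using card_large_eigenvalue_le[OF n] by (simp add: algebra_simps)
    then show ?thesis using pos[of n] by (simp add: pos_le_divide_eq)
  qed
  have "(\<lambda>n. exp (- real n / 24)) \<longlonglongrightarrow> 0"
  proof -
    have "(\<lambda>n. exp (- 1 / 24 :: real) ^ n) \<longlonglongrightarrow> 0" by (rule LIMSEQ_power_zero) simp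
    then show ?thesis by (simp flip: exp_of_nat_mult)
  qed
  then have "(\<lambda>n. 1 - exp (- real n / 24)) \<longlonglongrightarrow> 1"
    using tendsto_diff[OF tendsto_const] by force
  then show "?r \<longlonglongrightarrow> 1"
    by (rule tendsto_sandwich[rotated 2, OF _ tendsto_const])
       (use lower upper in \<open>auto intro: eventually_sequentiallyI[of 1]\<close>)
qed

end
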